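(* The space $(A^1)^\perp+C$ is a $C$-module; that is, if $\psi\in(A^1)^\perp+C$ and $h\in C$, then $h\psi\in(A^1)^\perp+C$.
   Context: $D$ is the open unit disc in $\mathbb{C}$, $dA=\frac1\pi r\,dr\,d\theta$ is normalized Lebesgue measure on $D$, and $L^\infty=L^\infty(D,dA)$ (complex-valued). The Bergman space $A^1$ is the Banach space of holomorphic functions $f$ on $D$ with $\|f\|=\int_D|f|\,dA<\infty$. The annihilator is $(A^1)^\perp=\{\psi\in L^\infty:\int_D f\overline{\psi}\,dA=0\text{ for all }f\in A^1\}$. $C=C(\overline{D})$ is the space of continuous complex functions on $\overline{D}$, regarded as a subspace of $L^\infty$. $(A^1)^\perp+C$ denotes the sum of these two subspaces. *)

theory Defs
  imports "HOL-Complex_Analysis.Complex_Analysis"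
begin

definition disc_measure :: "complex measure" where
  "disc_measure = scale_measure (ennreal (1 / pi)) (lebesgue_on (ball 0 1))"

text \<open>
  Elements of $L^\infty$ are represented by functions on the whole plane. Values off the open disc
  are irrelevant, and two representatives denote the same element iff they agree almost everywhere
  with respect to \<^const>\<open>disc_measure\<close>.
\<close>

definition Linf :: "(complex \<Rightarrow> complex) set" where
  "Linf = {\<psi>. \<psi> \<in> borel_measurable disc_measure \<and>
               (\<exists>B::real. AE z in disc_measure. norm (\<psi> z) \<le> B)}"

definition bergman1 :: "(complex \<Rightarrow> complex) set" where
  "bergman1 = {f. f holomorphic_on ball 0 1 \<and> integrable disc_measure f}"

definition bergman1_annihilator :: "(complex \<Rightarrow> complex) set" where
  "bergman1_annihilator =
     {\<psi> \<in> Linf. \<forall>f \<in> bergman1. (LINT z|disc_measure. f z * cnj (\<psi> z)) = 0}"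

definition cont_closed_disc :: "(complex \<Rightarrow> complex) set" where
  "cont_closed_disc = {g. continuous_on (cball 0 1) g}"

text \<open>
  The sum of the two subspaces of $L^\infty$. Equality in $L^\infty$ is equality almost everywhere,
  so this set contains all representatives of its elements.
\<close>

definition annihilator_plus_C :: "(complex \<Rightarrow> complex) set" where
  "annihilator_plus_C =
     {\<psi> \<in> Linf. \<exists>\<phi> \<in> bergman1_annihilator. \<exists>g \<in> cont_closed_disc.
        AE z in disc_measure. \<psi> z = \<phi> z + g z}"

end

theory Submission imports Defs begin

text \<open>
  Write $\psi = \alpha + g$ with $\alpha \perp A^1$. Subtract from $h\alpha$ the function
  $\varphi(w) = 2(1-|w|^2)\int_D h(z)\alpha(z)(1-w\bar z)^{-3}\,dA(z)$.
  By Fubini and the weighted reproducing formula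
  $f(z) = \int_D 2(1-|w|^2) f(w) (1-z\bar w)^{-3}\,dA(w)$ for $f \in A^1$, the difference
  $h\alpha - \varphi$ annihilates $A^1$. Since $\alpha$ is orthogonal to the kernel, $h(z)$ may be replaced by
  $h(z) - h(w)$ in the integral; together with
  $\int_D |1-w\bar z|^{-3}\,dA(z) = O(1/(1-|w|))$ and the uniform continuity of $h$ this
  shows that $\varphi$ tends to $0$ at the boundary, so $\varphi \in C$.

  The reproducing formula comes from averaging the integrand over rotations: by Cauchy's formula
  the mean over $|w| = r$ is $(1-r^2)\,G''(zr^2)$ with $G(u) = u^2 f(u)$, and as $|w|^2$ is uniformly
  distributed on $[0,1]$ the integral becomes $\int_0^1 (1-t)\,G''(tz)\,dt$, which is $G(z)/z^2 = f(z)$ by Taylor's formula.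
\<close>

subsection \<open>The normalized area measure\<close>

lemma space_disc_measure [simp]: "space disc_measure = ball 0 1"
  by (simp add: disc_measure_def space_scale_measure)

lemma sets_disc_measure [measurable_cong]: "sets disc_measure = sets (lebesgue_on (ball 0 1))"
  by (simp add: disc_measure_def)

lemma measurable_disc_measure_borel:
  assumes "f \<in> borel_measurable borel"
  shows "f \<in> borel_measurable disc_measure"
proof -
  have "f \<in> borel_measurable (lebesgue_on (ball 0 1))"
    using assms by (intro measurable_restrict_space1 measurable_completion) simp
  then show ?thesis
    by (simp add: measurable_cong_sets[OF sets_disc_measure refl])
qed

lemma id_measurable_disc_measure: "(\<lambda>z. z) \<in> borel_measurable disc_measure"
  by (rule measurable_disc_measure_borel) simp

lemma continuous_on_measurable_disc_measure:
  assumes "continuous_on (ball 0 1) f"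
  shows "f \<in> borel_measurable disc_measure"
proof -
  have "f \<in> borel_measurable (lebesgue_on (ball 0 1))"
    by (rule continuous_imp_measurable_on_sets_lebesgue[OF assms]) auto
  then show ?thesis
    by (simp add: measurable_cong_sets[OF sets_disc_measure refl])
qed

lemma emeasure_disc_measure:
  assumes "A \<in> sets borel"
  shows "emeasure disc_measure (A \<inter> ball 0 1) = emeasure lborel (A \<inter> ball 0 1) / ennreal pi"
  using assms
  by (auto simp: disc_measure_def emeasure_restrict_space ennreal_divide_times divide_ennreal[symmetric]
        mult.commute)

lemma emeasure_disc_measure_ball_le:
  assumes "0 \<le> r"
  shows "emeasure disc_measure (ball b r \<inter> ball 0 1) \<le> ennreal (r\<^sup>2)"
proof -
  have "emeasure disc_measure (ball b r \<inter> ball 0 1) = emeasure lborel (ball b r \<inter> ball 0 1) / ennreal pi"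
    by (rule emeasure_disc_measure) auto
  also have "\<dots> \<le> emeasure lborel (ball b r) / ennreal pi"
    by (intro divide_right_mono_ennreal emeasure_mono) auto
  also have "\<dots> = ennreal (r\<^sup>2)"
    using assms by (simp add: emeasure_ball unit_ball_vol_2 divide_ennreal)
  finally show ?thesis .
qed

lemma emeasure_disc_measure_centred_ball:
  assumes "0 \<le> r" "r \<le> 1"
  shows "emeasure disc_measure (ball 0 r) = ennreal (r\<^sup>2)"
proof -
  have "emeasure disc_measure (ball 0 r) = emeasure disc_measure (ball 0 r \<inter> ball 0 1)"
    using assms by (intro arg_cong[where f="emeasure disc_measure"]) auto
  also have "\<dots> = emeasure lborel (ball 0 r \<inter> ball 0 1 :: complex set) / ennreal pi"
    by (rule emeasure_disc_measure) auto
  also have "ball 0 r \<inter> ball 0 1 = (ball 0 r :: complex set)"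
    using assms by auto
  also have "emeasure lborel (ball 0 r :: complex set) / ennreal pi = ennreal (r\<^sup>2)"
    using assms by (simp add: emeasure_ball unit_ball_vol_2 divide_ennreal)
  finally show ?thesis .
qed

lemma emeasure_disc_measure_space [simp]: "emeasure disc_measure (ball 0 1) = 1"
  using emeasure_disc_measure_centred_ball[of 1] by simp

interpretation disc: finite_measure disc_measure
  by standard simp

lemma measure_disc_measure_space [simp]: "measure disc_measure (ball 0 1) = 1"
  by (simp add: measure_def)

section \<open>Rotation invariance of planar Lebesgue measure\<close>

lemma Basis_vec_2: "(Basis :: (real^2) set) = {axis 1 1, axis 2 1}"
  by (simp add: Basis_vec_def UNIV_2 insert_commute)

text \<open>Prepares the transfer of a fact about orthogonal maps from \<open>real^2\<close> to
  \<open>complex\<close>. Agreement on boxes determines Lebesgue measure, and the coordinate map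
  pulls a box back to a box with the same side lengths.\<close>

lemma lborel_distr_complex_of_vec:
  "distr lborel borel (\<lambda>v :: real^2. Complex (v $ 1) (v $ 2)) = lborel"
proof (rule lborel_eqI[symmetric])
  have meas: "(\<lambda>v :: real^2. Complex (v $ 1) (v $ 2)) \<in> borel_measurable borel"
    by (intro borel_measurable_continuous_onI continuous_on_Complex continuous_intros)
  fix l u :: complex
  assume le: "\<And>b. b \<in> Basis \<Longrightarrow> l \<bullet> b \<le> u \<bullet> b"
  have "(\<lambda>v :: real^2. Complex (v $ 1) (v $ 2)) -` box l u =
      box (vector [Re l, Im l]) (vector [Re u, Im u])"
    by (simp add: set_eq_iff mem_box_cart forall_2 in_box_complex_iff)
  moreover have "emeasure lborel (box (vector [Re l, Im l]) (vector [Re u, Im u]) :: (real^2) set) =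
      ennreal ((Re u - Re l) * (Im u - Im l))"
  proof -
    have "Re l \<le> Re u" "Im l \<le> Im u"
      using le[of 1] le[of \<i>] by (simp_all add: Basis_complex_def)
    then have "vector [Re l, Im l] \<bullet> b \<le> vector [Re u, Im u] \<bullet> b" if "b \<in> Basis" for b :: "real^2"
      using that unfolding Basis_vec_2 by (auto simp: inner_axis)
    from emeasure_lborel_box[OF this] show ?thesis
      by (simp add: Basis_vec_2 inner_axis axis_eq_axis)
  qed
  ultimately show "emeasure (distr lborel borel (\<lambda>v :: real^2. Complex (v $ 1) (v $ 2))) (box l u) =
      (\<Prod>b\<in>Basis. (u - l) \<bullet> b)"
    using meas by (simp add: emeasure_distr Basis_complex_def complex_eq_iff)
qed simp

text \<open>Read in the real coordinates \<open>T\<close>, multiplication by a unimodular number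
  \<open>d\<close> is the map \<open>R d\<close>, which is linear and norm-preserving. Orthogonal
  maps of \<open>real^2\<close> preserve Lebesgue measure, and \<open>T\<close> carries this back to
  the complex plane.\<close>

lemma lborel_distr_complex_mult:
  fixes c :: complex
  assumes "norm c = 1"
  shows "distr lborel borel ((*) c) = lborel"
proof -
  define T where "T = (\<lambda>v :: real^2. Complex (v $ 1) (v $ 2))"
  define R where "R = (\<lambda>d (v :: real^2). vector [Re (d * T v), Im (d * T v)] :: real^2)"
  have T: "T \<in> borel_measurable borel"
    unfolding T_def by (intro borel_measurable_continuous_onI continuous_on_Complex continuous_intros)
  have eT: "emeasure lborel (T -` X) = emeasure lborel X" if "X \<in> sets borel" for X
  proof -
    have "emeasure (distr lborel borel T) X = emeasure lborel (T -` X)"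
      using T that by (subst emeasure_distr) auto
    then show ?thesis
      by (simp only: lborel_distr_complex_of_vec[folded T_def])
  qed
  have TR: "T (R d v) = d * T v" for d v
    by (simp add: T_def R_def complex_eq_iff)
  have R_inv: "R d (R e v) = v" if "d * e = 1" for d e v
  proof -
    have "d * T (R e v) = T v" using that by (simp add: TR mult.assoc[symmetric])
    then have "R d (R e v) = vector [Re (T v), Im (T v)]" by (simp only: R_def)
    then show ?thesis by (simp add: T_def vec_eq_iff forall_2)
  qed
  have orth: "orthogonal_transformation (R d)" if "norm d = 1" for d
  proof -
    have "linear (R d)"
      by (rule linearI) (auto simp: R_def T_def vec_eq_iff forall_2 algebra_simps)
    moreover have "norm (R d v) = norm v" for v
    proof -
      have n: "norm v = norm (T v)" for v
        by (simp add: T_def norm_vec_def L2_set_def UNIV_2 cmod_def)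
      show ?thesis using that by (simp add: n[of v] n[of "R d v"] TR norm_mult)
    qed
    ultimately show ?thesis by (simp add: orthogonal_transformation)
  qed
  have c0: "c \<noteq> 0" using assms by auto
  show ?thesis
  proof (rule lborel_eqI[symmetric])
    fix l u :: complex
    assume le: "\<And>b. b \<in> Basis \<Longrightarrow> l \<bullet> b \<le> u \<bullet> b"
    define B where "B = T -` box l u"
    have Bs: "B \<in> sets borel" unfolding B_def
      using measurable_sets[OF T, of "box l u"] by simp
    have eB: "emeasure lborel B = emeasure lborel (box l u)"
      unfolding B_def by (rule eT) simp
    \<comment> \<open>The invariance under orthogonal maps is applied to \<open>lmeasurable\<close>
      sets, so finite measure must be recorded first; a box has it.\<close>
    then have "emeasure lborel B < \<infinity>" by (simp add: emeasure_lborel_box_eq)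
    then have Bm: "B \<in> lmeasurable"
      using Bs by (simp add: fmeasurable_def)
    \<comment> \<open>Invariance is available for images, while the push-forward asks for preimages;
      the inverse rotation turns one into the other.\<close>
    have im: "R c -` B = R (1 / c) ` B"
    proof safe
      fix x assume "R c x \<in> B"
      then show "x \<in> R (1 / c) ` B"
        using c0 by (intro image_eqI[of _ _ "R c x"]) (auto simp: R_inv)
    qed (use c0 in \<open>auto simp: R_inv\<close>)
    have n1: "norm (1 / c) = 1" using assms by (simp add: norm_divide)
    have "emeasure lebesgue (R c -` B) = emeasure lebesgue B"
      unfolding im using measurable_orthogonal_image[OF orth[OF n1] Bm]
        measure_orthogonal_image[OF orth[OF n1] Bm] Bm
      by (simp add: emeasure_eq_measure2)
    moreover have Rb: "R c -` B \<in> sets borel"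
      using Bs orth[OF assms]
      by (metis borel_measurable_continuous_onI linear_continuous_on linear_linear
          measurable_sets_borel orthogonal_transformation_linear)
    ultimately have "emeasure lborel (R c -` B) = emeasure lborel B"
      using Bs by simp
    moreover have "R c -` B = T -` ((*) c -` box l u)"
      by (auto simp: B_def TR)
    moreover have "emeasure lborel (T -` ((*) c -` box l u)) = emeasure lborel ((*) c -` box l u)"
      using measurable_sets_borel[of "(*) c" borel "box l u"] by (intro eT) simp
    ultimately show "emeasure (distr lborel borel ((*) c)) (box l u) = (\<Prod>b\<in>Basis. (u - l) \<bullet> b)"
      using eB le by (simp add: emeasure_distr emeasure_lborel_box)
  qed simp
qed


text \<open>A rotation maps the disc onto itself, so the planar invariance restricts to it. Since
  \<open>disc_measure\<close> lives on the Lebesgue subsets of the disc, both sides are pushed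
  forward to the Borel sets of the plane; the right-hand side is the disc measure itself in that
  guise.\<close>

lemma disc_measure_distr_mult:
  assumes "norm c = 1"
  shows "distr disc_measure borel ((*) c) = distr disc_measure borel (\<lambda>z. z)"
proof (rule measure_eqI)
  fix A :: "complex set"
  assume "A \<in> sets (distr disc_measure borel ((*) c))"
  then have A: "A \<in> sets borel" by simp
  have [measurable]: "(*) c \<in> borel_measurable borel" by simp
  have cA: "(*) c -` A \<in> sets borel"
    using A measurable_sets_borel[of "(*) c" borel A] by simp
  have "emeasure (distr disc_measure borel ((*) c)) A = emeasure disc_measure ((*) c -` A \<inter> ball 0 1)"
    using A by (subst emeasure_distr) (auto intro: measurable_disc_measure_borel)
  also have "\<dots> = emeasure lborel ((*) c -` (A \<inter> ball 0 1)) / ennreal pi"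
    using cA by (subst emeasure_disc_measure)
      (auto intro!: arg_cong[where f="\<lambda>X. emeasure lborel X / ennreal pi"] simp: norm_mult assms)
  also have "emeasure lborel ((*) c -` (A \<inter> ball 0 1)) = emeasure (distr lborel borel ((*) c)) (A \<inter> ball 0 1)"
    using A by (subst emeasure_distr) auto
  also have "\<dots> / ennreal pi = emeasure (distr disc_measure borel (\<lambda>z. z)) A"
    using A by (simp add: lborel_distr_complex_mult[OF assms] emeasure_distr
        id_measurable_disc_measure emeasure_disc_measure)
  finally show "emeasure (distr disc_measure borel ((*) c)) A = emeasure (distr disc_measure borel (\<lambda>z. z)) A" .
qed simp

text \<open>If |w| >= 1/2, then |1 - w conj z| = |w| |1/conj w - z| places the set in a disc of
  radius t/|w| <= 2t. If |w| < 1/2, then |1 - w conj z| > 1/2 on the disc: the set is empty for t <=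
  1/2, and for larger t the bound exceeds the total mass 1.\<close>

lemma emeasure_disc_measure_dist_le:
  assumes w: "norm w < 1" and t: "0 \<le> t"
  shows "emeasure disc_measure {z \<in> ball 0 1. norm (1 - w * cnj z) < t} \<le> ennreal (4 * t\<^sup>2)"
proof (cases "norm w < 1 / 2")
  case True
  show ?thesis
  proof (cases "t \<le> 1 / 2")
    case True
    have "{z \<in> ball 0 1. norm (1 - w * cnj z) < t} = {}"
    proof safe
      fix z :: complex assume z: "z \<in> ball 0 1" "norm (1 - w * cnj z) < t"
      have "norm (w * cnj z) \<le> norm w * 1"
        unfolding norm_mult using z by (intro mult_left_mono) auto
      moreover have "1 - norm (w * cnj z) \<le> norm (1 - w * cnj z)"
        by (metis norm_one norm_triangle_ineq2)
      ultimately show "z \<in> {}" using z True \<open>norm w < 1 / 2\<close> by linarith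
    qed
    then show ?thesis by (simp only: emeasure_empty) simp
  next
    case False
    then have "1 \<le> 4 * t\<^sup>2"
      using power_mono[of "1/2" t 2] by (simp add: power2_eq_square)
    then show ?thesis
      using emeasure_space[of disc_measure "{z \<in> ball 0 1. norm (1 - w * cnj z) < t}"]
      by (metis emeasure_disc_measure_space ennreal_1 ennreal_leI order_trans space_disc_measure)
  qed
next
  case False
  then have w0: "w \<noteq> 0" by auto
  have *: "norm (1 - w * cnj z) = norm w * norm (1 / cnj w - z)" for z
  proof -
    have "norm (1 - w * cnj z) = norm (cnj (1 - w * cnj z))"
      by (simp only: complex_mod_cnj)
    also have "cnj (1 - w * cnj z) = cnj w * (1 / cnj w - z)"
      using w0 by (simp add: field_simps)
    also have "norm \<dots> = norm w * norm (1 / cnj w - z)"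
      by (simp only: norm_mult complex_mod_cnj)
    finally show ?thesis .
  qed
  have "{z \<in> ball 0 1. norm (1 - w * cnj z) < t} \<subseteq> ball (1 / cnj w) (2 * t) \<inter> ball 0 1"
  proof safe
    fix z assume z: "norm (1 - w * cnj z) < t"
    have "1 / 2 * norm (1 / cnj w - z) \<le> norm w * norm (1 / cnj w - z)"
      using False by (intro mult_right_mono) auto
    then show "z \<in> ball (1 / cnj w) (2 * t)"
      using z * by (simp add: dist_norm)
  qed
  then have "emeasure disc_measure {z \<in> ball 0 1. norm (1 - w * cnj z) < t} \<le>
      emeasure disc_measure (ball (1 / cnj w) (2 * t) \<inter> ball 0 1)"
    by (intro emeasure_mono) (auto simp: sets_disc_measure sets_restrict_space image_iff
        intro!: bexI[of _ "ball (1 / cnj w) (2 * t)"])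
  also have "\<dots> \<le> ennreal ((2 * t)\<^sup>2)"
    using t by (intro emeasure_disc_measure_ball_le) auto
  finally show ?thesis by (simp add: power_mult_distrib)
qed

subsection \<open>The kernel\<close>

lemma norm_one_minus_mult_cnj_ge:
  fixes w z :: complex
  assumes "norm z \<le> 1"
  shows "1 - norm w \<le> norm (1 - w * cnj z)"
proof -
  have "norm (w * cnj z) \<le> norm w * 1"
    unfolding norm_mult using assms by (intro mult_left_mono) auto
  moreover have "1 - norm (w * cnj z) \<le> norm (1 - w * cnj z)"
    by (metis norm_one norm_triangle_ineq2)
  ultimately show ?thesis by linarith
qed

lemma one_minus_mult_cnj_nonzero:
  fixes w z :: complex
  assumes "norm w < 1" "norm z \<le> 1"
  shows "1 - w * cnj z \<noteq> 0"
  using norm_one_minus_mult_cnj_ge[OF assms(2), of w] assms by auto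

text \<open>Follows from the identity |1 - w conj z|^2 - |z - w|^2 = (1 - |w|^2)(1 - |z|^2). It
  keeps the kernel bounded when z stays away from w, uniformly as w approaches the circle.\<close>

lemma norm_diff_le_norm_one_minus_mult_cnj:
  fixes w z :: complex
  assumes "norm w \<le> 1" "norm z \<le> 1"
  shows "norm (z - w) \<le> norm (1 - w * cnj z)"
proof -
  have "(norm (1 - w * cnj z))\<^sup>2 - (norm (z - w))\<^sup>2 = (1 - (norm w)\<^sup>2) * (1 - (norm z)\<^sup>2)"
    unfolding cmod_power2 by (simp add: power2_eq_square algebra_simps)
  also have "\<dots> \<ge> 0"
    using assms by (intro mult_nonneg_nonneg) (auto simp: power_le_one)
  finally have "(norm (z - w))\<^sup>2 \<le> (norm (1 - w * cnj z))\<^sup>2" by linarith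
  then show ?thesis by (rule power2_le_imp_le) (rule norm_ge_zero)
qed

lemma measurable_kernel [measurable]:
  "(\<lambda>z. 1 / (1 - w * cnj z) ^ 3) \<in> borel_measurable borel"
  "(\<lambda>z. 1 - w * cnj z) \<in> borel_measurable borel"
proof -
  have [measurable]: "cnj \<in> borel_measurable borel"
    by (intro borel_measurable_continuous_onI continuous_intros)
  show "(\<lambda>z. 1 / (1 - w * cnj z) ^ 3) \<in> borel_measurable borel"
    "(\<lambda>z. 1 - w * cnj z) \<in> borel_measurable borel"
    by measurable
qed

text \<open>A single term of the sum already suffices: the one whose dyadic shell
  \<open>\<delta> * 2 ^ k \<le> x < \<delta> * 2 ^ Suc k\<close> contains \<open>x\<close>. The sum
  form is what can be integrated term by term.\<close>

lemma inverse_cube_le_dyadic_sum: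
  fixes x \<delta> :: real
  assumes "0 < \<delta>" "\<delta> \<le> x"
  shows "ennreal (1 / x ^ 3) \<le>
    (\<Sum>k. ennreal (1 / (\<delta> * 2 ^ k) ^ 3) * indicator {..<\<delta> * 2 ^ Suc k} x)"
proof -
  obtain n where n: "x / \<delta> < 2 ^ n"
    using real_arch_pow[of 2 "x / \<delta>"] by auto
  define m where "m = (LEAST n. x / \<delta> < 2 ^ n)"
  have m: "x / \<delta> < 2 ^ m"
    unfolding m_def by (rule LeastI[of _ n]) (rule n)
  \<comment> \<open>The hypothesis \<open>\<delta> \<le> x\<close> excludes exponent 0, so the least
    exponent has a predecessor, and that is the index of the shell.\<close>
  have "m \<noteq> 0" using m assms by (cases m) (auto simp: field_simps)
  then obtain k where k: "m = Suc k" using not0_implies_Suc by auto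
  have k': "\<not> x / \<delta> < 2 ^ k"
    using not_less_Least[of k "\<lambda>n. x / \<delta> < 2 ^ n"] k by (simp add: m_def)
  have le: "\<delta> * 2 ^ k \<le> x" using k' assms by (simp add: field_simps)
  have lt: "x < \<delta> * 2 ^ Suc k" using m k assms by (simp add: field_simps)
  have "ennreal (1 / x ^ 3) \<le> ennreal (1 / (\<delta> * 2 ^ k) ^ 3)"
    using le assms by (intro ennreal_leI divide_left_mono power_mono mult_pos_pos zero_less_power) auto
  also have "\<dots> = (\<Sum>i\<in>{k}. ennreal (1 / (\<delta> * 2 ^ i) ^ 3) * indicator {..<\<delta> * 2 ^ Suc i} x)"
    using lt by simp
  also have "\<dots> \<le> (\<Sum>k. ennreal (1 / (\<delta> * 2 ^ k) ^ 3) * indicator {..<\<delta> * 2 ^ Suc k} x)"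
    by (rule sum_le_suminf) auto
  finally show ?thesis .
qed

text \<open>With \<delta> = 1 - |w|, the smallest possible value of |1 - w conj z| is at least
  \<delta>. The shell of index k contributes at most (\<delta> 2^k)^(-3) * 4 (\<delta> 2^(k+1))^2 =
  (16/\<delta>) 2^(-k), a geometric series with sum 32/\<delta>.\<close>

lemma nn_integral_kernel_le:
  assumes w: "norm w < 1"
  shows "(\<integral>\<^sup>+z. ennreal (1 / norm (1 - w * cnj z) ^ 3) \<partial>disc_measure) \<le> ennreal (32 / (1 - norm w))"
proof -
  define \<delta> where "\<delta> = 1 - norm w"
  have \<delta>: "0 < \<delta>" using w by (simp add: \<delta>_def)
  let ?c = "\<lambda>k. ennreal (1 / (\<delta> * 2 ^ k) ^ 3)"
  let ?A = "\<lambda>k. {z \<in> ball 0 1. norm (1 - w * cnj z) < \<delta> * 2 ^ Suc k}"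
  have [measurable]: "(\<lambda>z. norm (1 - w * cnj z)) \<in> borel_measurable disc_measure"
    by (rule measurable_disc_measure_borel) simp
  have A: "?A k \<in> sets disc_measure" for k
  proof -
    have "{z \<in> space disc_measure. norm (1 - w * cnj z) < \<delta> * 2 ^ Suc k} \<in> sets disc_measure"
      by measurable
    then show ?thesis by simp
  qed
  have "(\<integral>\<^sup>+z. ennreal (1 / norm (1 - w * cnj z) ^ 3) \<partial>disc_measure) \<le>
      (\<integral>\<^sup>+z. (\<Sum>k. ?c k * indicator (?A k) z) \<partial>disc_measure)"
  proof (rule nn_integral_mono)
    fix z assume "z \<in> space disc_measure"
    then have z: "z \<in> ball 0 1" by simp
    have "indicator {..<\<delta> * 2 ^ Suc k} (norm (1 - w * cnj z)) = (indicator (?A k) z :: ennreal)" for k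
      using z by (simp add: indicator_def)
    then show "ennreal (1 / norm (1 - w * cnj z) ^ 3) \<le> (\<Sum>k. ?c k * indicator (?A k) z)"
      using inverse_cube_le_dyadic_sum[OF \<delta>, of "norm (1 - w * cnj z)"]
        norm_one_minus_mult_cnj_ge[of z w] z by (simp add: \<delta>_def)
  qed
  also have "\<dots> = (\<Sum>k. \<integral>\<^sup>+z. ?c k * indicator (?A k) z \<partial>disc_measure)"
    using A by (intro nn_integral_suminf) auto
  also have "\<dots> = (\<Sum>k. ?c k * emeasure disc_measure (?A k))"
    using A by (simp add: nn_integral_cmult_indicator)
  also have "\<dots> \<le> (\<Sum>k. ennreal (16 / \<delta> * (1 / 2) ^ k))"
  proof (rule suminf_le)
    fix k
    have "?c k * emeasure disc_measure (?A k) \<le> ?c k * ennreal (4 * (\<delta> * 2 ^ Suc k)\<^sup>2)"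
      using w \<delta> by (intro mult_left_mono emeasure_disc_measure_dist_le) auto
    also have "\<dots> = ennreal (1 / (\<delta> * 2 ^ k) ^ 3 * (4 * (\<delta> * 2 ^ Suc k)\<^sup>2))"
      using \<delta> by (intro ennreal_mult[symmetric]) auto
    also have "1 / (\<delta> * 2 ^ k) ^ 3 * (4 * (\<delta> * 2 ^ Suc k)\<^sup>2) = 16 / \<delta> * (1 / 2) ^ k"
      using \<delta> by (simp add: field_simps power2_eq_square power3_eq_cube)
    finally show "?c k * emeasure disc_measure (?A k) \<le> ennreal (16 / \<delta> * (1 / 2) ^ k)" .
  qed auto
  also have "\<dots> = ennreal (32 / \<delta>)"
  proof (rule suminf_ennreal_eq)
    show "(\<lambda>k. 16 / \<delta> * (1 / 2) ^ k) sums (32 / \<delta>)"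
      using sums_mult[OF geometric_sums[of "1 / 2 :: real"], of "16 / \<delta>"] by simp
  qed (use \<delta> in auto)
  finally show ?thesis by (simp add: \<delta>_def)
qed

lemma integrable_norm_kernel:
  assumes "norm w < 1"
  shows "integrable disc_measure (\<lambda>z. 1 / norm (1 - w * cnj z) ^ 3)"
    and "(LINT z|disc_measure. 1 / norm (1 - w * cnj z) ^ 3) \<le> 32 / (1 - norm w)"
proof -
  have m: "(\<lambda>z. 1 / norm (1 - w * cnj z) ^ 3) \<in> borel_measurable disc_measure"
    by (rule measurable_disc_measure_borel) simp
  show i: "integrable disc_measure (\<lambda>z. 1 / norm (1 - w * cnj z) ^ 3)"
    using m le_less_trans[OF nn_integral_kernel_le[OF assms]]
    by (intro integrableI_nonneg) auto
  have "ennreal (LINT z|disc_measure. 1 / norm (1 - w * cnj z) ^ 3) \<le> ennreal (32 / (1 - norm w))"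
    using nn_integral_kernel_le[OF assms] nn_integral_eq_integral[OF i] by simp
  then show "(LINT z|disc_measure. 1 / norm (1 - w * cnj z) ^ 3) \<le> 32 / (1 - norm w)"
    using assms by (subst (asm) ennreal_le_iff) auto
qed

text \<open>This is the adjoint, for the pairing of A^1 with L^\<infinity>, of the Bergman
  projection with weight 2(1 - |w|^2). The weight vanishes for |w| = 1, so the formula itself gives
  the boundary value 0.\<close>

definition bergman_potential :: "(complex \<Rightarrow> complex) \<Rightarrow> complex \<Rightarrow> complex" where
  "bergman_potential u w =
     2 * (1 - (complex_of_real (norm w))\<^sup>2) * (LINT z|disc_measure. u z / (1 - w * cnj z) ^ 3)"

lemma integrable_bounded_times_kernel:
  assumes u: "u \<in> borel_measurable disc_measure" and B: "AE z in disc_measure. norm (u z) \<le> B"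
    and w: "norm w < 1"
  shows "integrable disc_measure (\<lambda>z. u z / (1 - w * cnj z) ^ 3)"
proof (rule Bochner_Integration.integrable_bound)
  show "integrable disc_measure (\<lambda>z. B * (1 / norm (1 - w * cnj z) ^ 3))"
    using integrable_norm_kernel(1)[OF w] by (rule integrable_mult_right)
  have "(\<lambda>z. 1 / (1 - w * cnj z) ^ 3) \<in> borel_measurable disc_measure"
    by (rule measurable_disc_measure_borel) simp
  from borel_measurable_times[OF u this]
  show "(\<lambda>z. u z / (1 - w * cnj z) ^ 3) \<in> borel_measurable disc_measure" by simp
  show "AE z in disc_measure. norm (u z / (1 - w * cnj z) ^ 3) \<le> norm (B * (1 / norm (1 - w * cnj z) ^ 3))"
    using B
  proof eventually_elim
    case (elim z)
    then have "norm (u z) \<le> \<bar>B\<bar>" by linarith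
    then show ?case
      by (simp add: norm_divide norm_power abs_mult divide_right_mono)
  qed
qed

text \<open>For |w| < r < 1 the constant \<open>B / (1 - r) ^ 3\<close> dominates the integrand and
  is integrable because the measure is finite. Dominated convergence gives continuity on each
  smaller disc, and these exhaust the unit disc.\<close>

lemma continuous_on_kernel_integral:
  assumes u: "u \<in> borel_measurable disc_measure" and B: "AE z in disc_measure. norm (u z) \<le> B"
  shows "continuous_on (ball 0 1) (\<lambda>w. LINT z|disc_measure. u z / (1 - w * cnj z) ^ 3)"
proof -
  let ?F = "\<lambda>w. LINT z|disc_measure. u z / (1 - w * cnj z) ^ 3"
  have "continuous_on (ball 0 r) ?F" if r: "r < 1" for r
    unfolding continuous_on_sequentially
  proof (intro ballI allI impI, elim conjE)
    fix a :: complex and x assume a: "a \<in> ball 0 r" and x: "\<forall>n. x n \<in> ball 0 r" and lim: "x \<longlonglongrightarrow> a"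
    have nx: "norm (x n) < 1" for n using x r by (auto intro: less_trans)
    have na: "norm a < 1" using a r by auto
    show "(?F \<circ> x) \<longlonglongrightarrow> ?F a"
      unfolding comp_def
    proof (rule integral_dominated_convergence[where w="\<lambda>_. B / (1 - r) ^ 3"])
      show "(\<lambda>z. u z / (1 - a * cnj z) ^ 3) \<in> borel_measurable disc_measure"
        using integrable_bounded_times_kernel[OF u B na] by auto
      show "(\<lambda>z. u z / (1 - x n * cnj z) ^ 3) \<in> borel_measurable disc_measure" for n
        using integrable_bounded_times_kernel[OF u B nx] by auto
      show "AE z in disc_measure. (\<lambda>n. u z / (1 - x n * cnj z) ^ 3) \<longlonglongrightarrow> u z / (1 - a * cnj z) ^ 3"
      proof (rule AE_I2)
        fix z assume "z \<in> space disc_measure"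
        then have "1 - a * cnj z \<noteq> 0"
          using na by (intro one_minus_mult_cnj_nonzero) auto
        then show "(\<lambda>n. u z / (1 - x n * cnj z) ^ 3) \<longlonglongrightarrow> u z / (1 - a * cnj z) ^ 3"
          by (intro tendsto_intros lim) auto
      qed
      show "AE z in disc_measure. norm (u z / (1 - x n * cnj z) ^ 3) \<le> B / (1 - r) ^ 3" for n
        using B AE_space
      proof eventually_elim
        case (elim z)
        have "1 - r \<le> 1 - norm (x n)" using x[rule_format, of n] by auto
        also have "\<dots> \<le> norm (1 - x n * cnj z)"
          using elim by (intro norm_one_minus_mult_cnj_ge) auto
        finally have "(1 - r) ^ 3 \<le> norm (1 - x n * cnj z) ^ 3"
          using r by (intro power_mono) auto
        then show ?case
          using elim r unfolding norm_divide norm_power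
          by (intro frac_le) (auto intro: order_trans[OF norm_ge_zero])
      qed
    qed simp
  qed
  then have "continuous (at w) ?F" if "w \<in> ball 0 1" for w
    using that dense[of "norm w" 1] by (auto simp: continuous_on_eq_continuous_at)
  then show ?thesis by (simp add: continuous_at_imp_continuous_on)
qed

subsection \<open>Boundary behaviour of the potential\<close>

lemma cont_closed_disc_bounded:
  assumes "h \<in> cont_closed_disc"
  obtains M where "M > 0" "\<And>z. norm z \<le> 1 \<Longrightarrow> norm (h z) \<le> M"
proof -
  have "bounded (h ` cball 0 1)"
    using assms unfolding cont_closed_disc_def
    by (intro compact_imp_bounded compact_continuous_image) auto
  then show ?thesis
    using that unfolding bounded_pos by auto
qed

lemma cont_closed_disc_measurable:
  assumes "h \<in> cont_closed_disc"
  shows "h \<in> borel_measurable disc_measure"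
  using assms unfolding cont_closed_disc_def
  by (intro continuous_on_measurable_disc_measure) (auto elim: continuous_on_subset)

lemma Linf_mult_cont:
  assumes "\<psi> \<in> Linf" "h \<in> cont_closed_disc"
  shows "(\<lambda>z. h z * \<psi> z) \<in> Linf"
proof -
  obtain B where B: "AE z in disc_measure. norm (\<psi> z) \<le> B"
    using assms by (auto simp: Linf_def)
  obtain M where M: "M > 0" "\<And>z. norm z \<le> 1 \<Longrightarrow> norm (h z) \<le> M"
    using cont_closed_disc_bounded[OF assms(2)] by blast
  have "AE z in disc_measure. norm (h z * \<psi> z) \<le> M * B"
    using B AE_space
    by eventually_elim (use M in \<open>auto simp: norm_mult intro!: mult_mono\<close>)
  then show ?thesis
    using assms cont_closed_disc_measurable[OF assms(2)] by (auto simp: Linf_def)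
qed

text \<open>For fixed w in the disc the conjugate of the kernel is holomorphic in z and integrable,
  hence an admissible test function in \<open>bergman1\<close>; the integral is the conjugate of its
  pairing with \<open>\<alpha>\<close>.\<close>

lemma annihilator_kernel_integral_eq_0:
  assumes \<alpha>: "\<alpha> \<in> bergman1_annihilator" and w: "norm w < 1"
  shows "(LINT z|disc_measure. \<alpha> z / (1 - w * cnj z) ^ 3) = 0"
proof -
  let ?f = "\<lambda>z. 1 / (1 - cnj w * z) ^ 3"
  have f: "?f = (\<lambda>z. cnj (1 / (1 - w * cnj z) ^ 3))" by simp
  have "?f holomorphic_on ball 0 1"
  proof (intro holomorphic_intros)
    fix z :: complex assume "z \<in> ball 0 1"
    then have "1 - cnj w * cnj (cnj z) \<noteq> 0"
      using w by (intro one_minus_mult_cnj_nonzero) auto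
    then show "(1 - cnj w * z) ^ 3 \<noteq> 0" by simp
  qed
  moreover have "integrable disc_measure (\<lambda>z. 1 / (1 - w * cnj z) ^ 3)"
    using w by (intro integrable_bounded_times_kernel[where B=1]) auto
  then have "integrable disc_measure ?f" unfolding f by (simp only: complex_integrable_cnj)
  ultimately have "?f \<in> bergman1" by (simp add: bergman1_def)
  then have "(LINT z|disc_measure. ?f z * cnj (\<alpha> z)) = 0"
    using \<alpha> by (auto simp: bergman1_annihilator_def)
  moreover have "(\<lambda>z. ?f z * cnj (\<alpha> z)) = (\<lambda>z. cnj (\<alpha> z / (1 - w * cnj z) ^ 3))" by auto
  ultimately show ?thesis by (simp only: Bochner_Integration.integral_cnj complex_cnj_zero_iff)
qed

text \<open>Puts the weight into the form that cancels the factor 1/(1 - |w|) from the integral of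
  the kernel.\<close>

lemma norm_weight_le:
  fixes w :: complex
  assumes "norm w \<le> 1"
  shows "norm (2 * (1 - (complex_of_real (norm w))\<^sup>2)) \<le> 4 * (1 - norm w)"
proof -
  have "1 - (norm w)\<^sup>2 = (1 + norm w) * (1 - norm w)"
    by (simp add: power2_eq_square algebra_simps)
  moreover have "(1 + norm w) * (1 - norm w) \<le> 2 * (1 - norm w)" "0 \<le> (1 + norm w) * (1 - norm w)"
    using assms by (intro mult_right_mono mult_nonneg_nonneg; simp)+
  moreover have "2 * (1 - (complex_of_real (norm w))\<^sup>2) = complex_of_real (2 * (1 - (norm w)\<^sup>2))"
    by simp
  ultimately show ?thesis by (simp only: norm_of_real)
qed

text \<open>Subtracting \<open>h w\<close> times the vanishing integral of \<open>\<alpha>\<close>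
  against the kernel replaces h(z) by h(z) - h(w). Where z is within d of w this difference is at
  most e, and the weight times the kernel integral costs only the factor 4 * 32 = 128. Elsewhere the
  kernel is at most d^(-3), so the weight alone makes the contribution small. The choice of \<eta>
  depends on 1 - |w| only, which makes the decay uniform along the circle.\<close>

lemma bergman_potential_boundary:
  assumes \<alpha>: "\<alpha> \<in> bergman1_annihilator" and h: "h \<in> cont_closed_disc" and \<epsilon>: "\<epsilon> > 0"
  shows "\<exists>\<eta>>0. \<forall>w. norm w < 1 \<and> 1 - norm w < \<eta> \<longrightarrow>
    norm (bergman_potential (\<lambda>z. h z * \<alpha> z) w) < \<epsilon>"
proof -
  have am: "\<alpha> \<in> borel_measurable disc_measure"
    using \<alpha> by (simp add: bergman1_annihilator_def Linf_def)
  obtain B0 where B0: "AE z in disc_measure. norm (\<alpha> z) \<le> B0"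
    using \<alpha> by (auto simp: bergman1_annihilator_def Linf_def)
  define B where "B = max 0 B0"
  have B: "AE z in disc_measure. norm (\<alpha> z) \<le> B" and B_nonneg: "B \<ge> 0"
    using B0 by (auto simp: B_def elim: eventually_mono)
  have hc: "continuous_on (cball 0 1) h" using h by (simp add: cont_closed_disc_def)
  have hm: "h \<in> borel_measurable disc_measure"
    by (rule cont_closed_disc_measurable[OF h])
  obtain M where M: "M > 0" "\<And>z. z \<in> cball 0 1 \<Longrightarrow> norm (h z) \<le> M"
    using cont_closed_disc_bounded[OF h] by auto
  \<comment> \<open>Chosen so that the near part, at most \<open>128 * (B + 1) * e\<close>, equals
    \<epsilon>/2; \<open>B + 1\<close> avoids dividing by zero.\<close>
  define e where "e = \<epsilon> / (256 * (B + 1))"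
  have e: "e > 0" using \<epsilon> B_nonneg by (simp add: e_def)
  have "uniformly_continuous_on (cball 0 1) h"
    using hc by (intro compact_uniformly_continuous) auto
  then obtain d where d: "d > 0"
    "\<And>z w. z \<in> cball 0 1 \<Longrightarrow> w \<in> cball 0 1 \<Longrightarrow> dist z w < d \<Longrightarrow> dist (h z) (h w) < e"
    unfolding uniformly_continuous_on_def using e by metis
  \<comment> \<open>Bounds |h(z) - h(w)| / |1 - w conj z|^3 when z and w are at least d apart:
    \<open>2 * M\<close> for the numerator and d^3 for the denominator.\<close>
  define K where "K = 2 * M / d ^ 3"
  have K: "K \<ge> 0" using M d by (simp add: K_def)
  \<comment> \<open>Makes the far part, at most \<open>(4 * B * K + 1) * (1 - norm w)\<close>,
    smaller than \<epsilon>/2.\<close>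
  define \<eta> where "\<eta> = \<epsilon> / (2 * (4 * B * K + 1))"
  have \<eta>: "\<eta> > 0" using \<epsilon> B_nonneg K by (simp add: \<eta>_def add_nonneg_pos)
  show ?thesis
  proof (intro exI[of _ \<eta>] conjI allI impI \<eta>, elim conjE)
    fix w :: complex assume w: "norm w < 1" and w\<eta>: "1 - norm w < \<eta>"
    let ?N = "\<lambda>z. norm (1 - w * cnj z) ^ 3"
    have ha: "AE z in disc_measure. norm (h z * \<alpha> z) \<le> M * B"
      using B AE_space by eventually_elim (use M in \<open>auto simp: norm_mult intro!: mult_mono\<close>)
    have i1: "integrable disc_measure (\<lambda>z. h z * \<alpha> z / (1 - w * cnj z) ^ 3)"
      by (rule integrable_bounded_times_kernel[OF _ ha w]) (use hm am in simp)
    have i2: "integrable disc_measure (\<lambda>z. \<alpha> z / (1 - w * cnj z) ^ 3)"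
      by (rule integrable_bounded_times_kernel[OF am B w])
    have "(LINT z|disc_measure. h z * \<alpha> z / (1 - w * cnj z) ^ 3) =
        (LINT z|disc_measure. h z * \<alpha> z / (1 - w * cnj z) ^ 3) -
        h w * (LINT z|disc_measure. \<alpha> z / (1 - w * cnj z) ^ 3)"
      by (simp add: annihilator_kernel_integral_eq_0[OF \<alpha> w])
    also have "\<dots> = (LINT z|disc_measure. h z * \<alpha> z / (1 - w * cnj z) ^ 3 - h w * (\<alpha> z / (1 - w * cnj z) ^ 3))"
      using Bochner_Integration.integral_diff[OF i1 integrable_mult_right[OF i2, of "h w"]]
      by (simp only: integral_mult_right_zero)
    also have "norm \<dots> \<le> (LINT z|disc_measure. B * (e * (1 / ?N z) + K))"
    proof (rule order_trans[OF integral_norm_bound integral_mono_AE])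
      show "integrable disc_measure (\<lambda>z. norm (h z * \<alpha> z / (1 - w * cnj z) ^ 3 - h w * (\<alpha> z / (1 - w * cnj z) ^ 3)))"
        by (intro integrable_norm Bochner_Integration.integrable_diff integrable_mult_right i1 i2)
      show "integrable disc_measure (\<lambda>z. B * (e * (1 / ?N z) + K))"
        by (intro integrable_mult_right Bochner_Integration.integrable_add
            integrable_norm_kernel(1)[OF w] disc.integrable_const)
      have bound: "norm (h z * \<alpha> z / (1 - w * cnj z) ^ 3 - h w * (\<alpha> z / (1 - w * cnj z) ^ 3)) \<le>
          B * (e * (1 / ?N z) + K)" if zB: "norm (\<alpha> z) \<le> B" and z1: "norm z < 1" for z
      proof -
        have zw: "z \<in> cball 0 1" "w \<in> cball 0 1" using z1 w by auto
        have "norm (h z - h w) / ?N z \<le> e * (1 / ?N z) + K"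
        proof (cases "dist z w < d")
          case True
          then have "norm (h z - h w) \<le> e"
            using d(2)[OF zw] by (simp add: dist_norm)
          then have "norm (h z - h w) / ?N z \<le> e / ?N z" by (intro divide_right_mono) auto
          then show ?thesis using K by simp
        next
          case False
          then have "d \<le> norm (1 - w * cnj z)"
            using norm_diff_le_norm_one_minus_mult_cnj[of w z] zw by (simp add: dist_norm)
          then have "d ^ 3 \<le> ?N z" using d by (intro power_mono) auto
          moreover have "norm (h z - h w) \<le> 2 * M"
            using norm_triangle_ineq4[of "h z" "h w"] M(2)[OF zw(1)] M(2)[OF zw(2)] by linarith
          ultimately have "norm (h z - h w) / ?N z \<le> K"
            unfolding K_def using d M by (intro frac_le) auto
          moreover have "e * (1 / ?N z) \<ge> 0" using e by simp
          ultimately show ?thesis by linarith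
        qed
        then have "norm (\<alpha> z) * (norm (h z - h w) / ?N z) \<le> B * (e * (1 / ?N z) + K)"
          using zB B_nonneg by (intro mult_mono) auto
        moreover have "h z * \<alpha> z / (1 - w * cnj z) ^ 3 - h w * (\<alpha> z / (1 - w * cnj z) ^ 3) =
            \<alpha> z * ((h z - h w) / (1 - w * cnj z) ^ 3)"
          by (simp add: diff_divide_distrib algebra_simps)
        ultimately show ?thesis by (simp only: norm_mult norm_divide norm_power)
      qed
      show "AE z in disc_measure. norm (h z * \<alpha> z / (1 - w * cnj z) ^ 3 - h w * (\<alpha> z / (1 - w * cnj z) ^ 3)) \<le>
          B * (e * (1 / ?N z) + K)"
        using B AE_space by eventually_elim (rule bound, auto)
    qed
    also have "\<dots> = B * (e * (LINT z|disc_measure. 1 / ?N z) + K)"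
      using Bochner_Integration.integral_add[OF
          integrable_mult_right[OF integrable_norm_kernel(1)[OF w], of e] disc.integrable_const[of K]]
      by (simp only: integral_mult_right_zero lebesgue_integral_const) simp
    also have "\<dots> \<le> B * (e * (32 / (1 - norm w)) + K)"
      using integrable_norm_kernel(2)[OF w] B_nonneg e
      by (intro mult_left_mono add_right_mono) auto
    finally have le: "norm (LINT z|disc_measure. h z * \<alpha> z / (1 - w * cnj z) ^ 3) \<le>
        B * (e * (32 / (1 - norm w)) + K)" .
    note norm_weight_le[OF less_imp_le[OF w]]
    then have "norm (bergman_potential (\<lambda>z. h z * \<alpha> z) w) \<le>
        4 * (1 - norm w) * (B * (e * (32 / (1 - norm w)) + K))"
      unfolding bergman_potential_def norm_mult[of "2 * (1 - (complex_of_real (norm w))\<^sup>2)"]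
      using le w by (intro mult_mono) auto
    also have "\<dots> = 128 * B * e + (4 * B * K) * (1 - norm w)"
      using w by (simp add: field_simps)
    \<comment> \<open>The added 1 in the second coefficient keeps it positive, so that the next
      comparison is strict even if \<open>B * K = 0\<close>.\<close>
    also have "\<dots> \<le> 128 * (B + 1) * e + (4 * B * K + 1) * (1 - norm w)"
      using w e by (intro add_mono mult_right_mono) auto
    also have "\<dots> < 128 * (B + 1) * e + (4 * B * K + 1) * \<eta>"
      using w\<eta> B_nonneg K by (intro add_strict_left_mono mult_strict_left_mono add_nonneg_pos) auto
    also have "\<dots> = \<epsilon>"
    proof -
      have "B + 1 \<noteq> 0" "4 * B * K + 1 \<noteq> 0"
        using B_nonneg K by (auto simp: add_nonneg_eq_0_iff)
      then have "128 * (B + 1) * e = \<epsilon> / 2" "(4 * B * K + 1) * \<eta> = \<epsilon> / 2"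
        by (simp_all only: e_def \<eta>_def) (simp_all add: divide_simps)
      then show ?thesis by simp
    qed
    finally show "norm (bergman_potential (\<lambda>z. h z * \<alpha> z) w) < \<epsilon>" .
  qed
qed

text \<open>Inside the disc this is continuity of the weight and of the kernel integral. At a point
  w of the circle the value is 0, and 1 - |x| <= |x - w| turns the uniform boundary decay into
  continuity.\<close>

lemma continuous_on_bergman_potential:
  assumes \<alpha>: "\<alpha> \<in> bergman1_annihilator" and h: "h \<in> cont_closed_disc"
  shows "continuous_on (cball 0 1) (bergman_potential (\<lambda>z. h z * \<alpha> z))"
proof -
  let ?u = "\<lambda>z. h z * \<alpha> z"
  have u: "?u \<in> borel_measurable disc_measure" and "\<exists>B. AE z in disc_measure. norm (?u z) \<le> B"
    using Linf_mult_cont[of \<alpha> h] assms by (auto simp: bergman1_annihilator_def Linf_def)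
  then obtain B where B: "AE z in disc_measure. norm (?u z) \<le> B" by blast
  have "continuous_on (ball 0 1) (bergman_potential ?u)"
    unfolding bergman_potential_def
    by (intro continuous_intros continuous_on_kernel_integral[OF u B])
  then have inside: "isCont (bergman_potential ?u) w" if "norm w < 1" for w
    using that by (simp add: continuous_on_eq_continuous_at)
  have outside: "bergman_potential ?u w = 0" if "norm w = 1" for w
    using that by (simp add: bergman_potential_def)
  have "continuous (at w within cball 0 1) (bergman_potential ?u)" if w: "w \<in> cball 0 1" for w
  proof (cases "norm w < 1")
    case True
    then show ?thesis using continuous_at_imp_continuous_at_within[OF inside] by blast
  next
    case False
    then have w1: "norm w = 1" using w by simp
    show ?thesis
      unfolding continuous_within_eps_delta
    proof (intro allI impI)
      fix e :: real assume "e > 0"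
      then obtain \<eta> where \<eta>: "\<eta> > 0"
        "\<And>w. norm w < 1 \<Longrightarrow> 1 - norm w < \<eta> \<Longrightarrow> norm (bergman_potential ?u w) < e"
        using bergman_potential_boundary[OF \<alpha> h] by blast
      show "\<exists>d>0. \<forall>x'\<in>cball 0 1. dist x' w < d \<longrightarrow>
          dist (bergman_potential ?u x') (bergman_potential ?u w) < e"
      proof (intro exI[of _ \<eta>] conjI ballI impI \<eta>(1))
        fix x assume x: "x \<in> cball 0 1" "dist x w < \<eta>"
        have "1 - norm x < \<eta>"
          using x norm_triangle_ineq2[of w x] w1 by (simp add: dist_norm norm_minus_commute)
        then show "dist (bergman_potential ?u x) (bergman_potential ?u w) < e"
          using x \<eta>(2)[of x] outside[OF w1] outside[of x] \<open>e > 0\<close> by (cases "norm x < 1") auto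
      qed
    qed
  qed
  then show ?thesis by (simp add: continuous_on_eq_continuous_within)
qed

subsection \<open>The weighted reproducing formula\<close>

lemma integral_disc_measure_rotate:
  fixes g :: "complex \<Rightarrow> 'b::{banach, second_countable_topology}"
  assumes "g \<in> borel_measurable borel" "norm c = 1"
  shows "(LINT z|disc_measure. g (c * z)) = (LINT z|disc_measure. g z)"
    and "integrable disc_measure (\<lambda>z. g (c * z)) \<longleftrightarrow> integrable disc_measure g"
proof -
  have c: "(*) c \<in> borel_measurable disc_measure"
    by (rule measurable_disc_measure_borel) simp
  show "(LINT z|disc_measure. g (c * z)) = (LINT z|disc_measure. g z)"
    using integral_distr[OF c assms(1)] integral_distr[OF id_measurable_disc_measure assms(1)]
    by (simp add: disc_measure_distr_mult[OF assms(2)])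
  show "integrable disc_measure (\<lambda>z. g (c * z)) \<longleftrightarrow> integrable disc_measure g"
    using integrable_distr_eq[OF c assms(1)] integrable_distr_eq[OF id_measurable_disc_measure assms(1)]
    by (simp add: disc_measure_distr_mult[OF assms(2)])
qed

text \<open>Half-lines determine the measure. For x in [0,1] the condition 1 - |z|^2 > x describes
  the disc of radius sqrt(1 - x), whose normalized area is 1 - x. The variable 1 - |z|^2 is
  preferred to |z|^2 because it is the weight of the reproducing formula up to the factor 2.\<close>

lemma disc_measure_distr_one_minus_norm_sq:
  "distr disc_measure borel (\<lambda>z. 1 - (norm z)\<^sup>2) = density lborel (\<lambda>t. ennreal (indicator {0..1} t))"
    (is "?L = ?R")
proof (rule measure_eqI_lessThan)
  have m: "(\<lambda>z::complex. 1 - (norm z)\<^sup>2) \<in> borel_measurable disc_measure"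
    by (rule measurable_disc_measure_borel) simp
  have L: "emeasure ?L {x<..} = emeasure disc_measure {z \<in> ball 0 1. x < 1 - (norm z)\<^sup>2}" for x
    using m by (subst emeasure_distr) (auto intro!: arg_cong[where f="emeasure disc_measure"])
  have R: "emeasure ?R {x<..} = emeasure lborel ({0..1} \<inter> {x<..})" for x :: real
    by (subst emeasure_density) (auto simp: indicator_inter_arith[symmetric] ennreal_indicator nn_integral_indicator
      simp flip: indicator_inter_arith)
  show "emeasure ?L {x<..} < \<infinity>" for x
    unfolding L infinity_ennreal_def less_top[symmetric]
    by (rule disc.emeasure_finite[unfolded infinity_ennreal_def])
  show "emeasure ?L {x<..} = emeasure ?R {x<..}" for x
  proof -
    consider "x < 0" | "0 \<le> x" "x \<le> 1" | "1 < x" by linarith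
    then show ?thesis
    proof cases
      case 1
      have "{z \<in> ball 0 1. x < 1 - (norm z)\<^sup>2} = (ball 0 1 :: complex set)"
        using 1 by (auto intro: less_le_trans[of x 0] simp: power_le_one)
      moreover have "{0..1} \<inter> {x<..} = {0..1}" using 1 by auto
      ultimately show ?thesis by (simp add: L R)
    next
      case 2
      have "{z \<in> ball 0 1. x < 1 - (norm z)\<^sup>2} = (ball 0 (sqrt (1 - x)) :: complex set)"
      proof -
        have "norm z < 1 \<and> x < 1 - (norm z)\<^sup>2 \<longleftrightarrow> norm z < sqrt (1 - x)" for z :: complex
        proof -
          have "norm z < sqrt (1 - x) \<longleftrightarrow> (norm z)\<^sup>2 < 1 - x"
            by (metis abs_norm_cancel real_less_rsqrt real_sqrt_abs real_sqrt_less_iff)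
          moreover have "norm z < 1" if "(norm z)\<^sup>2 < 1 - x"
            using that 2 power2_less_imp_less[of "norm z" 1] by simp
          moreover have "x < 1 - (norm z)\<^sup>2 \<longleftrightarrow> (norm z)\<^sup>2 < 1 - x" by linarith
          ultimately show ?thesis by blast
        qed
        then show ?thesis by (intro set_eqI) (simp only: mem_Collect_eq mem_ball_0)
      qed
      moreover have "emeasure disc_measure (ball 0 (sqrt (1 - x))) = ennreal (1 - x)"
        using 2 by (subst emeasure_disc_measure_centred_ball) auto
      moreover have "{0..1} \<inter> {x<..} = {x<..1}" using 2 by auto
      ultimately show ?thesis using 2 by (simp add: L R)
    next
      case 3
      have "{z \<in> ball 0 1. x < 1 - (norm z)\<^sup>2} = ({} :: complex set)"
      proof -
        have "\<not> x < 1 - (norm z)\<^sup>2" for z :: complex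
          using 3 zero_le_power2[of "norm z"] by linarith
        then show ?thesis by auto
      qed
      moreover have "{0..1} \<inter> {x<..} = {}" using 3 by auto
      ultimately show ?thesis unfolding L R by (simp only: emeasure_empty)
    qed
  qed
qed simp_all

lemma integral_disc_measure_radial:
  fixes g :: "real \<Rightarrow> complex"
  assumes "continuous_on {0..1} g"
  shows "(LINT z|disc_measure. g (1 - (norm z)\<^sup>2)) = (LINT t|lborel. indicator {0..1} t *\<^sub>R g t)"
proof -
  \<comment> \<open>Since \<open>g\<close> is continuous on [0,1] only, cutting it off there makes
    it Borel on the whole line, as the push-forward rule requires.\<close>
  let ?g = "\<lambda>t. indicator {0..1} t *\<^sub>R g t"
  have g: "?g \<in> borel_measurable borel"
    by (rule borel_measurable_continuous_on_indicator[OF _ assms]) simp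
  have m: "(\<lambda>z::complex. 1 - (norm z)\<^sup>2) \<in> borel_measurable disc_measure"
    by (rule measurable_disc_measure_borel) simp
  have "(LINT z|disc_measure. g (1 - (norm z)\<^sup>2)) = (LINT z|disc_measure. ?g (1 - (norm z)\<^sup>2))"
    by (intro Bochner_Integration.integral_cong) (auto simp: power_le_one)
  also have "\<dots> = integral\<^sup>L (distr disc_measure borel (\<lambda>z. 1 - (norm z)\<^sup>2)) ?g"
    by (rule integral_distr[OF m g, symmetric])
  also have "\<dots> = (LINT t|lborel. indicator {0..1} t *\<^sub>R ?g t)"
    unfolding disc_measure_distr_one_minus_norm_sq using g by (subst integral_density) auto
  also have "\<dots> = (LINT t|lborel. ?g t)"
    by (intro Bochner_Integration.integral_cong) (auto simp: indicator_def)
  finally show ?thesis .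
qed

text \<open>The second derivative of G(u) = u^2 f(u), expanded by the product rule.\<close>

definition deriv2_sq_mult :: "(complex \<Rightarrow> complex) \<Rightarrow> complex \<Rightarrow> complex" where
  "deriv2_sq_mult f u = 2 * f u + 4 * u * deriv f u + u\<^sup>2 * deriv (deriv f) u"

text \<open>For w nonzero, c^2 f(cw) = G(cw)/w^2 with G(u) = u^2 f(u), so two derivatives in c give
  G''(cw). Differentiating directly avoids the division and covers w = 0 as well.\<close>

lemma deriv2_sq_mult_scaled:
  assumes f: "f holomorphic_on ball 0 1" and cw: "norm (c * w) < 1"
  shows "(deriv ^^ 2) (\<lambda>c. c\<^sup>2 * f (c * w)) c = deriv2_sq_mult f (c * w)"
proof -
  let ?S = "{c. norm (c * w) < 1}"
  have S: "open ?S" by (intro open_Collect_less continuous_intros)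
  have f': "deriv f holomorphic_on ball 0 1" by (intro holomorphic_deriv f) auto
  have D: "((\<lambda>c. g (c * w)) has_field_derivative deriv g (c * w) * w) (at c)"
    if "g holomorphic_on ball 0 1" "c \<in> ?S" for g c
  proof -
    have "(g has_field_derivative deriv g (c * w)) (at (c * w))"
      using that by (intro holomorphic_derivI[of g "ball 0 1"]) auto
    moreover have "((\<lambda>c. c * w) has_field_derivative w) (at c)"
      by (auto intro!: derivative_eq_intros)
    ultimately show ?thesis by (rule DERIV_chain2)
  qed
  let ?F1 = "\<lambda>c. 2 * c * f (c * w) + c\<^sup>2 * (deriv f (c * w) * w)"
  have d1: "((\<lambda>c. c\<^sup>2 * f (c * w)) has_field_derivative ?F1 c) (at c)" if "c \<in> ?S" for c
    by (rule derivative_eq_intros D[OF f that] refl)+ simp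
  have d2: "(?F1 has_field_derivative deriv2_sq_mult f (c * w)) (at c)"
  proof -
    define g0 g1 where "g0 = (\<lambda>c. f (c * w))" and "g1 = (\<lambda>c. deriv f (c * w))"
    have g0: "(g0 has_field_derivative deriv f (c * w) * w) (at c)"
      and g1: "(g1 has_field_derivative deriv (deriv f) (c * w) * w) (at c)"
      unfolding g0_def g1_def using cw by (auto intro!: D f f')
    have "((\<lambda>c. 2 * c * g0 c + c\<^sup>2 * (g1 c * w)) has_field_derivative
        2 * g0 c + 2 * c * (deriv f (c * w) * w) + (2 * c * (g1 c * w) + c\<^sup>2 * (deriv (deriv f) (c * w) * w * w))) (at c)"
      by (rule derivative_eq_intros g0 g1 refl)+ (simp add: algebra_simps)
    then show ?thesis
      by (simp add: g0_def g1_def deriv2_sq_mult_def power2_eq_square algebra_simps)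
  qed
  have "eventually (\<lambda>c. deriv (\<lambda>c. c\<^sup>2 * f (c * w)) c = ?F1 c) (nhds c)"
    using cw by (intro eventually_nhds_in_open[OF S, THEN eventually_mono] DERIV_imp_deriv d1) auto
  then have "deriv (deriv (\<lambda>c. c\<^sup>2 * f (c * w))) c = deriv ?F1 c"
    by (intro deriv_cong_ev) auto
  also have "\<dots> = deriv2_sq_mult f (c * w)" by (rule DERIV_imp_deriv[OF d2])
  finally show ?thesis by (simp add: numeral_2_eq_2)
qed

text \<open>On |c| = 1 one has conj c = 1/c, hence 1 - z conj(cw) = (c - p)/c with p = z conj w. As
  dc = 2 pi i c dt, the mean becomes Cauchy's integral for the second derivative of c^2 f(cw) at p,
  where p w = z |w|^2. The division by 2 is the factorial 2! in that formula.\<close>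

lemma kernel_circle_mean:
  assumes f: "f holomorphic_on ball 0 1" and z: "norm z < 1" and w: "norm w < 1"
  shows "((\<lambda>t. f (circlepath 0 1 t * w) / (1 - z * cnj (circlepath 0 1 t * w)) ^ 3) has_integral
    deriv2_sq_mult f (z * (complex_of_real (norm w))\<^sup>2) / 2) {0..1}"
proof -
  let ?F = "\<lambda>c. c\<^sup>2 * f (c * w)"
  let ?p = "z * cnj w"
  have cw: "norm (c * w) < 1" if "norm c \<le> 1" for c
    using mult_right_mono[OF that, of "norm w"] w by (simp add: norm_mult)
  have "(f \<circ> (\<lambda>c. c * w)) holomorphic_on cball 0 1"
    by (rule holomorphic_on_compose_gen[OF _ f]) (use cw in \<open>auto intro!: holomorphic_intros\<close>)
  then have hol: "(\<lambda>c. f (c * w)) holomorphic_on cball 0 1"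
    by (simp only: o_def)
  have F: "?F holomorphic_on cball 0 1"
    by (intro holomorphic_intros hol)
  have p: "norm ?p < 1" using cw[of "cnj z"] z by (simp add: norm_mult)
  have pw: "norm (?p * w) < 1" using cw p by simp
  have "((\<lambda>u. ?F u / (u - ?p) ^ Suc 2) has_contour_integral
      (2 * pi * \<i>) / fact 2 * (deriv ^^ 2) ?F ?p) (circlepath 0 1)"
    using F p by (intro Cauchy_has_contour_integral_higher_derivative_circlepath)
      (auto intro: holomorphic_on_imp_continuous_on holomorphic_on_subset)
  also have "(deriv ^^ 2) ?F ?p = deriv2_sq_mult f (z * (complex_of_real (norm w))\<^sup>2)"
  proof -
    have "?p * w = z * (complex_of_real (norm w))\<^sup>2"
      using complex_norm_square[of w] by (simp add: mult_ac)
    then show ?thesis unfolding deriv2_sq_mult_scaled[OF f pw] by (simp only:)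
  qed
  finally have "((\<lambda>t. ?F (circlepath 0 1 t) / (circlepath 0 1 t - ?p) ^ 3 * (2 * pi * \<i> * circlepath 0 1 t))
      has_integral (2 * pi * \<i>) * (deriv2_sq_mult f (z * (complex_of_real (norm w))\<^sup>2) / 2)) {0..1}"
    unfolding has_contour_integral vector_derivative_circlepath
    by (simp add: circlepath numeral_3_eq_3 mult_ac)
  then have "((\<lambda>t. 1 / (2 * pi * \<i>) * (?F (circlepath 0 1 t) / (circlepath 0 1 t - ?p) ^ 3 * (2 * pi * \<i> * circlepath 0 1 t)))
      has_integral 1 / (2 * pi * \<i>) * ((2 * pi * \<i>) * (deriv2_sq_mult f (z * (complex_of_real (norm w))\<^sup>2) / 2))) {0..1}"
    by (rule has_integral_mult_right)
  moreover have "1 / (2 * pi * \<i>) * (?F (circlepath 0 1 t) / (circlepath 0 1 t - ?p) ^ 3 * (2 * pi * \<i> * circlepath 0 1 t)) =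
      f (circlepath 0 1 t * w) / (1 - z * cnj (circlepath 0 1 t * w)) ^ 3" for t
  proof -
    define u where "u = circlepath 0 1 t"
    have nu: "norm u = 1" unfolding u_def circlepath by simp
    then have u0: "u \<noteq> 0" by auto
    have cu: "cnj u = 1 / u"
      using nu u0 complex_norm_square[of u] by (simp add: field_simps)
    have "1 - z * cnj (u * w) = (u - ?p) / u"
      using u0 by (simp add: cu field_simps)
    then have "f (u * w) / (1 - z * cnj (u * w)) ^ 3 = f (u * w) * u ^ 3 / (u - ?p) ^ 3"
      by (simp add: power_divide)
    also have "\<dots> = ?F u / (u - ?p) ^ 3 * u"
      by (simp add: power3_eq_cube power2_eq_square)
    also have "\<dots> = 1 / (2 * pi * \<i>) * (?F u / (u - ?p) ^ 3 * (2 * pi * \<i> * u))"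
    proof -
      have "X * u = 1 / a * (X * (a * u))" if "a \<noteq> 0" for a X :: complex
        using that by simp
      note this[of "2 * pi * \<i>" "?F u / (u - ?p) ^ 3"]
      moreover have "2 * pi * \<i> \<noteq> 0" by simp
      ultimately show ?thesis by (rule meta_mp)
    qed
    finally show ?thesis unfolding u_def ..
  qed
  ultimately show ?thesis by simp
qed

section \<open>Taylor's formula along a radius\<close>

lemma norm_mult_one_minus_less_1:
  fixes z :: complex
  assumes "norm z < 1" "0 \<le> t" "t \<le> 1"
  shows "norm (z * (1 - complex_of_real t)) < 1"
proof -
  have "norm (1 - complex_of_real t) = 1 - t"
    using assms norm_of_real[of "1 - t", where 'a=complex] by simp
  then show ?thesis
    using assms mult_left_le[of "1 - t" "norm z"] by (simp add: norm_mult)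
qed

lemma continuous_on_deriv2_sq_mult_radial:
  assumes f: "f holomorphic_on ball 0 1" and z: "norm z < 1"
  shows "continuous_on {0..1} (\<lambda>t. complex_of_real t * deriv2_sq_mult f (z * complex_of_real (1 - t)))"
proof -
  have f': "deriv f holomorphic_on ball 0 1" and f'': "deriv (deriv f) holomorphic_on ball 0 1"
    by (intro holomorphic_deriv f; simp)+
  have "continuous_on {0..1} (\<lambda>t. g (z * (1 - complex_of_real t)))" if "g holomorphic_on ball 0 1" for g
    by (rule continuous_on_compose2[OF holomorphic_on_imp_continuous_on[OF that]])
      (use norm_mult_one_minus_less_1[OF z] in \<open>auto intro!: continuous_intros\<close>)
  from this[OF f] this[OF f'] this[OF f''] show ?thesis
    unfolding deriv2_sq_mult_def of_real_diff of_real_1 by (intro continuous_intros)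
qed

lemma radial_integral_deriv2_sq_mult:
  assumes f: "f holomorphic_on ball 0 1" and z: "norm z < 1"
  shows "(LINT t|lborel. indicator {0..1} t *\<^sub>R (complex_of_real t * deriv2_sq_mult f (z * complex_of_real (1 - t)))) = f z"
proof -
  \<comment> \<open>With F(c) = c^2 f(cz), this is Q(s) = -(s F'(1 - s) + F(1 - s)), so that Q'(s) =
    s F''(1 - s), the integrand. Since F and F' vanish at 0, Q(1) = 0, while Q(0) = -F(1) = -f(z).
    The variable is complex so that the rules for holomorphic derivatives apply before restriction
    to real s.\<close>
  define Q where "Q = (\<lambda>s::complex. - (s * (2 * (1 - s) * f (z * (1 - s)) + (1 - s)\<^sup>2 * z * deriv f (z * (1 - s)))
    + (1 - s)\<^sup>2 * f (z * (1 - s))))"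
  have f': "deriv f holomorphic_on ball 0 1"
    by (intro holomorphic_deriv f; simp)
  note nz = norm_mult_one_minus_less_1[OF z]
  have D: "((\<lambda>s. g (z * (1 - s))) has_field_derivative - (deriv g (z * (1 - s)) * z)) (at s)"
    if "g holomorphic_on ball 0 1" "norm (z * (1 - s)) < 1" for g s
  proof -
    have "(g has_field_derivative deriv g (z * (1 - s))) (at (z * (1 - s)))"
      using that by (intro holomorphic_derivI[of g "ball 0 1"]) auto
    moreover have "((\<lambda>s. z * (1 - s)) has_field_derivative - z) (at s)"
      by (auto intro!: derivative_eq_intros)
    ultimately have "((\<lambda>s. g (z * (1 - s))) has_field_derivative deriv g (z * (1 - s)) * - z) (at s)"
      by (rule DERIV_chain2)
    then show ?thesis by simp
  qed
  have Q': "(Q has_field_derivative s * deriv2_sq_mult f (z * (1 - s))) (at s)"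
    if s: "norm (z * (1 - s)) < 1" for s
    unfolding Q_def
    by (rule derivative_eq_intros D[OF f s] D[OF f' s] refl)+
      (auto simp: deriv2_sq_mult_def power2_eq_square algebra_simps)
  have "(LINT t|lborel. indicator {0..1} t *\<^sub>R (complex_of_real t * deriv2_sq_mult f (z * (1 - complex_of_real t)))) =
      Q (complex_of_real 1) - Q (complex_of_real 0)"
  proof (rule integral_FTC_atLeastAtMost)
    show "((\<lambda>t. Q (complex_of_real t)) has_vector_derivative
        complex_of_real t * deriv2_sq_mult f (z * (1 - complex_of_real t))) (at t within {0..1})"
      if "0 \<le> t" "t \<le> 1" for t
      by (rule has_vector_derivative_real_field Q' nz that)+
    show "continuous_on {0..1} (\<lambda>t. complex_of_real t * deriv2_sq_mult f (z * (1 - complex_of_real t)))"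
      using continuous_on_deriv2_sq_mult_radial[OF f z] by simp
  qed simp
  then show ?thesis by (simp add: Q_def)
qed

text \<open>Integrability holds because, for fixed z, the weight is at most 4 and the kernel at most
  (1 - |z|)^(-3), leaving a multiple of |f|. The identity follows by averaging over rotations,
  exchanging the integrals, and then evaluating first the circle means and then the radial
  integral.\<close>

theorem bergman1_reproducing:
  assumes f: "f \<in> bergman1" and z: "norm z < 1"
  shows "(LINT w|disc_measure. 2 * (1 - (complex_of_real (norm w))\<^sup>2) * f w / (1 - z * cnj w) ^ 3) = f z"
    and "integrable disc_measure (\<lambda>w. 2 * (1 - (complex_of_real (norm w))\<^sup>2) * f w / (1 - z * cnj w) ^ 3)"
proof -
  have hol: "f holomorphic_on ball 0 1" and int: "integrable disc_measure f"
    using f by (auto simp: bergman1_def)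
  let ?g = "\<lambda>w. 2 * (1 - (complex_of_real (norm w))\<^sup>2) * f w / (1 - z * cnj w) ^ 3"
  \<comment> \<open>Extension by zero makes the integrand Borel on the whole plane, as required for
    transport along rotations.\<close>
  define g where "g = (\<lambda>w. indicator (ball 0 1) w *\<^sub>R ?g w)"
  have cont: "continuous_on (ball 0 1) ?g"
    using one_minus_mult_cnj_nonzero[OF z]
    by (intro continuous_intros holomorphic_on_imp_continuous_on hol) auto
  have gm [measurable]: "g \<in> borel_measurable borel"
    unfolding g_def by (intro borel_measurable_continuous_on_indicator cont) simp
  have g_eq: "g w = ?g w" if "norm w < 1" for w using that by (simp add: g_def)
  have gi: "integrable disc_measure ?g"
  proof (rule Bochner_Integration.integrable_bound)
    show "integrable disc_measure (\<lambda>w. 4 / (1 - norm z) ^ 3 * norm (f w))"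
      using int by (intro integrable_mult_right integrable_norm)
    show "?g \<in> borel_measurable disc_measure"
      by (rule continuous_on_measurable_disc_measure[OF cont])
    show "AE w in disc_measure. norm (?g w) \<le> norm (4 / (1 - norm z) ^ 3 * norm (f w))"
    proof (rule AE_I2)
      fix w assume "w \<in> space disc_measure"
      then have w: "norm w < 1" by simp
      have "norm (2 * (1 - (complex_of_real (norm w))\<^sup>2)) \<le> 4"
        by (rule order_trans[OF norm_weight_le[OF less_imp_le[OF w]]]) simp
      moreover have "(1 - norm z) ^ 3 \<le> norm (1 - z * cnj w) ^ 3"
        using w z by (intro power_mono norm_one_minus_mult_cnj_ge) auto
      ultimately have "norm (?g w) \<le> 4 * norm (f w) / (1 - norm z) ^ 3"
        unfolding norm_divide norm_power norm_mult[of _ "f w"]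
        using z by (intro frac_le mult_right_mono) auto
      then show "norm (?g w) \<le> norm (4 / (1 - norm z) ^ 3 * norm (f w))"
        using z by simp
    qed
  qed
  then show "integrable disc_measure ?g" .
  have gi': "integrable disc_measure g"
    using gi by (rule Bochner_Integration.integrable_cong[THEN iffD1, rotated 2])
      (auto simp: g_eq)
  \<comment> \<open>The parameter interval of the circle; its total mass 1 turns integration over
    \<open>L\<close> into an average.\<close>
  define L where "L = restrict_space lborel {0..1::real}"
  let ?e = "circlepath 0 1"
  have ne: "norm (?e t) = 1" for t by (simp add: circlepath)
  interpret L: finite_measure L
    unfolding L_def by (rule finite_measureI) (simp add: emeasure_restrict_space)
  have L1: "measure L (space L) = 1"
    by (simp add: L_def measure_restrict_space)
  interpret P: pair_sigma_finite L disc_measure ..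
  have [measurable]: "(\<lambda>p. fst p) \<in> borel_measurable (L \<Otimes>\<^sub>M disc_measure)"
    unfolding L_def
    by (rule measurable_compose[OF measurable_fst]) (intro measurable_restrict_space1, simp)
  have [measurable]: "(\<lambda>p. snd p) \<in> borel_measurable (L \<Otimes>\<^sub>M disc_measure)"
    by (rule measurable_compose[OF measurable_snd id_measurable_disc_measure])
  have [measurable]: "?e \<in> borel_measurable borel"
    unfolding circlepath by (intro borel_measurable_continuous_onI continuous_intros)
  have em: "(\<lambda>p. g (?e (fst p) * snd p)) \<in> borel_measurable (L \<Otimes>\<^sub>M disc_measure)"
    by measurable
  have P: "integrable (L \<Otimes>\<^sub>M disc_measure) (\<lambda>p. g (?e (fst p) * snd p))"
  proof (rule P.Fubini_integrable[OF em])
    have gn: "(\<lambda>w. norm (g w)) \<in> borel_measurable borel" by measurable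
    \<comment> \<open>Rotation invariance makes the inner integral of the norm independent of t,
      hence integrable over the finite measure \<open>L\<close>.\<close>
    have "(LINT w|disc_measure. norm (g (?e t * w))) = (LINT w|disc_measure. norm (g w))" for t
      using integral_disc_measure_rotate(1)[OF gn ne[of t]] .
    then show "integrable L (\<lambda>t. LINT w|disc_measure. norm (g (?e (fst (t, w)) * snd (t, w))))"
      by simp
    show "AE t in L. integrable disc_measure (\<lambda>w. g (?e (fst (t, w)) * snd (t, w)))"
      using integral_disc_measure_rotate(2)[OF gm ne] gi' by simp
  qed
  \<comment> \<open>Writing |w|^2 as 1 - (1 - |w|^2) exhibits the mean as a function of 1 - |w|^2,
    the variable that is uniformly distributed on [0,1].\<close>
  have inner: "(LINT t|L. g (?e t * w)) =
      complex_of_real (1 - (norm w)\<^sup>2) * deriv2_sq_mult f (z * complex_of_real (1 - (1 - (norm w)\<^sup>2)))"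
    if w: "norm w < 1" for w
  proof -
    let ?c = "2 * (1 - (complex_of_real (norm w))\<^sup>2)"
    let ?k = "\<lambda>t. f (?e t * w) / (1 - z * cnj (?e t * w)) ^ 3"
    have nw: "norm (?e t * w) = norm w" for t by (simp add: norm_mult ne)
    have ge: "g (?e t * w) = ?c * ?k t" for t
      using g_eq[of "?e t * w"] w by (simp add: nw)
    have "continuous_on {0..1} (\<lambda>t. ?e t * w)"
      unfolding circlepath by (intro continuous_intros)
    then have ck: "continuous_on {0..1} (\<lambda>t. ?g (?e t * w))"
      by (rule continuous_on_compose2[OF cont]) (use nw w in auto)
    have "(LINT t|L. g (?e t * w)) = (LINT t:{0..1}|lborel. ?g (?e t * w))"
      using w nw g_eq unfolding L_def set_lebesgue_integral_def
      by (subst integral_restrict_space) (auto intro!: Bochner_Integration.integral_cong)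
    also have "\<dots> = integral {0..1} (\<lambda>t. ?g (?e t * w))"
      by (intro set_borel_integral_eq_integral borel_integrable_atLeastAtMost' ck)
    also have "\<dots> = integral {0..1} (\<lambda>t. ?c * ?k t)"
      by (simp only: nw times_divide_eq_right)
    also have "\<dots> = ?c * (deriv2_sq_mult f (z * (complex_of_real (norm w))\<^sup>2) / 2)"
      using kernel_circle_mean[OF hol z w] by (intro integral_unique has_integral_mult_right)
    also have "\<dots> = (1 - (complex_of_real (norm w))\<^sup>2) * deriv2_sq_mult f (z * (complex_of_real (norm w))\<^sup>2)"
      by simp
    finally show ?thesis by (simp only: of_real_diff of_real_1 of_real_power diff_diff_eq2 add_diff_cancel_left' add_diff_cancel_right')
  qed
  have "(LINT w|disc_measure. ?g w) = (LINT w|disc_measure. g w)"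
    by (intro Bochner_Integration.integral_cong) (auto simp: g_eq)
  also have "\<dots> = (LINT t|L. LINT w|disc_measure. g (?e t * w))"
    using L1 by (simp add: integral_disc_measure_rotate(1)[OF gm ne])
  also have "\<dots> = (LINT w|disc_measure. LINT t|L. g (?e t * w))"
    using P by (intro P.Fubini_integral[symmetric]) (simp add: case_prod_beta')
  also have "\<dots> = (LINT w|disc_measure. complex_of_real (1 - (norm w)\<^sup>2) *
      deriv2_sq_mult f (z * complex_of_real (1 - (1 - (norm w)\<^sup>2))))"
    by (intro Bochner_Integration.integral_cong refl inner) simp
  also have "\<dots> = (LINT t|lborel. indicator {0..1} t *\<^sub>R
      (complex_of_real t * deriv2_sq_mult f (z * complex_of_real (1 - t))))"
    by (rule integral_disc_measure_radial) (rule continuous_on_deriv2_sq_mult_radial[OF hol z])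
  also have "\<dots> = f z" by (rule radial_integral_deriv2_sq_mult[OF hol z])
  finally show "(LINT w|disc_measure. ?g w) = f z" .
qed

subsection \<open>Duality and the module property\<close>

lemma measurable_fst_disc: "f \<in> borel_measurable disc_measure \<Longrightarrow>
    (\<lambda>p. f (fst p)) \<in> borel_measurable (disc_measure \<Otimes>\<^sub>M disc_measure)"
  by (rule measurable_compose[OF measurable_fst])

lemma measurable_snd_disc: "f \<in> borel_measurable disc_measure \<Longrightarrow>
    (\<lambda>p. f (snd p)) \<in> borel_measurable (disc_measure \<Otimes>\<^sub>M disc_measure)"
  by (rule measurable_compose[OF measurable_snd])

text \<open>Conjugating the potential produces the reproducing kernel at z, so after Fubini the
  integral over w returns f(z). Fubini applies because the weight absorbs the growth of the kernel
  integral: the inner integral of the norm is at most 4(1 - |w|) |f(w)| * 32 B/(1 - |w|) = 128 B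
  |f(w)|.\<close>

lemma integral_bergman1_times_cnj_potential:
  assumes f: "f \<in> bergman1" and u: "u \<in> Linf"
  shows "(LINT w|disc_measure. f w * cnj (bergman_potential u w)) = (LINT z|disc_measure. f z * cnj (u z))"
proof -
  have int: "integrable disc_measure f" using f by (simp add: bergman1_def)
  then have fm [measurable]: "f \<in> borel_measurable disc_measure" by simp
  have um [measurable]: "u \<in> borel_measurable disc_measure" using u by (simp add: Linf_def)
  obtain B0 where B0: "AE z in disc_measure. norm (u z) \<le> B0" using u by (auto simp: Linf_def)
  define B where "B = max 0 B0"
  have B: "AE z in disc_measure. norm (u z) \<le> B" and B_nonneg: "B \<ge> 0"
    using B0 by (auto simp: B_def elim: eventually_mono)
  let ?c = "\<lambda>w::complex. 2 * (1 - (complex_of_real (norm w))\<^sup>2)"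
  define k where "k = (\<lambda>w z. ?c w * f w * (cnj (u z) / (1 - z * cnj w) ^ 3))"
  interpret P: pair_sigma_finite disc_measure disc_measure ..
  have id1: "(\<lambda>p. fst p) \<in> borel_measurable (disc_measure \<Otimes>\<^sub>M disc_measure)"
    by (rule measurable_fst_disc[OF id_measurable_disc_measure])
  have id2: "(\<lambda>p. snd p) \<in> borel_measurable (disc_measure \<Otimes>\<^sub>M disc_measure)"
    by (rule measurable_snd_disc[OF id_measurable_disc_measure])
  have [measurable]: "cnj \<in> borel_measurable borel"
    by (intro borel_measurable_continuous_onI continuous_intros)
  have km: "case_prod k \<in> borel_measurable (disc_measure \<Otimes>\<^sub>M disc_measure)"
    unfolding k_def case_prod_beta'
    using id1 id2 measurable_fst_disc[OF fm] measurable_snd_disc[OF um] by measurable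
  \<comment> \<open>The denominators 1 - z conj w and 1 - w conj z are conjugate, so their moduli
    agree and the estimate for the kernel in the variable z applies.\<close>
  have nk: "norm (k w z) = norm (?c w * f w) * (norm (u z) * (1 / norm (1 - w * cnj z) ^ 3))" for w z
  proof -
    have "norm (1 - z * cnj w) = norm (cnj (1 - z * cnj w))" by (simp only: complex_mod_cnj)
    also have "cnj (1 - z * cnj w) = 1 - w * cnj z" by simp
    finally show ?thesis by (simp only: k_def norm_mult norm_divide norm_power complex_mod_cnj) simp
  qed
  have ik: "integrable disc_measure (\<lambda>z. cnj (u z) / (1 - z * cnj w) ^ 3)" if "norm w < 1" for w
  proof -
    have "integrable disc_measure (\<lambda>z. cnj (u z / (1 - w * cnj z) ^ 3))"
      using integrable_bounded_times_kernel[OF um B that] by (simp only: complex_integrable_cnj)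
    then show ?thesis by (simp add: mult.commute)
  qed
  have K: "integrable (disc_measure \<Otimes>\<^sub>M disc_measure) (case_prod k)"
  proof (rule P.Fubini_integrable[OF km])
    show "integrable disc_measure (\<lambda>w. LINT z|disc_measure. norm (case_prod k (w, z)))"
    proof (rule Bochner_Integration.integrable_bound)
      show "integrable disc_measure (\<lambda>w. 128 * B * norm (f w))"
        using int by (intro integrable_mult_right integrable_norm)
      show "(\<lambda>w. LINT z|disc_measure. norm (case_prod k (w, z))) \<in> borel_measurable disc_measure"
        using km by measurable
      show "AE w in disc_measure. norm (LINT z|disc_measure. norm (case_prod k (w, z))) \<le> norm (128 * B * norm (f w))"
      proof (rule AE_I2)
        fix w assume "w \<in> space disc_measure"
        then have w: "norm w < 1" by simp
        have "(LINT z|disc_measure. norm (k w z)) \<le>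
            (LINT z|disc_measure. norm (?c w * f w) * (B * (1 / norm (1 - w * cnj z) ^ 3)))"
        proof (rule integral_mono_AE')
          show "integrable disc_measure (\<lambda>z. norm (?c w * f w) * (B * (1 / norm (1 - w * cnj z) ^ 3)))"
            by (intro integrable_mult_right integrable_norm_kernel(1)[OF w])
          show "AE z in disc_measure. norm (k w z) \<le> norm (?c w * f w) * (B * (1 / norm (1 - w * cnj z) ^ 3))"
            using B unfolding nk by eventually_elim (intro mult_left_mono mult_right_mono; simp)
        qed (use B_nonneg in auto)
        also have "\<dots> = norm (?c w * f w) * (B * (LINT z|disc_measure. 1 / norm (1 - w * cnj z) ^ 3))"
          by (simp only: integral_mult_right_zero)
        also have "\<dots> \<le> (4 * (1 - norm w) * norm (f w)) * (B * (32 / (1 - norm w)))"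
          unfolding norm_mult[of _ "f w"] using w B_nonneg
          by (intro mult_mono norm_weight_le integrable_norm_kernel(2)) auto
        also have "\<dots> = 128 * B * norm (f w)" using w by (simp add: field_simps)
        finally show "norm (LINT z|disc_measure. norm (case_prod k (w, z))) \<le> norm (128 * B * norm (f w))"
          using B_nonneg by simp
      qed
    qed
    show "AE w in disc_measure. integrable disc_measure (\<lambda>z. case_prod k (w, z))"
      unfolding k_def case_prod_conv by (intro AE_I2 integrable_mult_right ik) simp
  qed
  have "(LINT w|disc_measure. f w * cnj (bergman_potential u w)) = (LINT w|disc_measure. LINT z|disc_measure. k w z)"
  proof (rule Bochner_Integration.integral_cong)
    fix w assume "w \<in> space disc_measure"
    have "cnj (bergman_potential u w) = ?c w * (LINT z|disc_measure. cnj (u z / (1 - w * cnj z) ^ 3))"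
      unfolding Bochner_Integration.integral_cnj by (simp add: bergman_potential_def)
    also have "(\<lambda>z. cnj (u z / (1 - w * cnj z) ^ 3)) = (\<lambda>z. cnj (u z) / (1 - z * cnj w) ^ 3)"
      by (simp add: mult.commute)
    finally show "f w * cnj (bergman_potential u w) = (LINT z|disc_measure. k w z)"
      unfolding k_def integral_mult_right_zero by (simp only: mult_ac)
  qed simp
  also have "\<dots> = (LINT z|disc_measure. LINT w|disc_measure. k w z)"
    by (rule P.Fubini_integral[OF K, symmetric])
  also have "\<dots> = (LINT z|disc_measure. f z * cnj (u z))"
  proof (rule Bochner_Integration.integral_cong)
    fix z assume "z \<in> space disc_measure"
    then have z: "norm z < 1" by simp
    have "(LINT w|disc_measure. k w z) = (LINT w|disc_measure. (?c w * f w / (1 - z * cnj w) ^ 3) * cnj (u z))"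
      unfolding k_def by (intro Bochner_Integration.integral_cong) auto
    also have "\<dots> = f z * cnj (u z)"
      unfolding integral_mult_left_zero bergman1_reproducing(1)[OF f z] ..
    finally show "(LINT w|disc_measure. k w z) = f z * cnj (u z)" .
  qed simp
  finally show ?thesis .
qed

lemma integrable_bergman1_times_cnj_Linf:
  assumes "f \<in> bergman1" "u \<in> Linf"
  shows "integrable disc_measure (\<lambda>z. f z * cnj (u z))"
proof -
  have int: "integrable disc_measure f" using assms by (simp add: bergman1_def)
  obtain B where B: "AE z in disc_measure. norm (u z) \<le> B" using assms by (auto simp: Linf_def)
  have um: "u \<in> borel_measurable disc_measure" using assms by (simp add: Linf_def)
  have [measurable]: "cnj \<in> borel_measurable borel"
    by (intro borel_measurable_continuous_onI continuous_intros)
  show ?thesis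
  proof (rule Bochner_Integration.integrable_bound)
    show "integrable disc_measure (\<lambda>z. B * norm (f z))"
      using int by (intro integrable_mult_right integrable_norm)
    show "(\<lambda>z. f z * cnj (u z)) \<in> borel_measurable disc_measure"
      using um borel_measurable_integrable[OF int] by measurable
    show "AE z in disc_measure. norm (f z * cnj (u z)) \<le> norm (B * norm (f z))"
      using B
    proof eventually_elim
      case (elim z)
      then have "norm (u z) \<le> \<bar>B\<bar>" by linarith
      then have "norm (f z) * norm (u z) \<le> norm (f z) * \<bar>B\<bar>" by (rule mult_left_mono) simp
      then show ?case by (simp add: norm_mult abs_mult mult.commute)
    qed
  qed
qed

lemma cont_closed_disc_Linf:
  assumes "h \<in> cont_closed_disc"
  shows "h \<in> Linf"
proof -
  obtain M where "\<And>z. norm z \<le> 1 \<Longrightarrow> norm (h z) \<le> M"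
    using cont_closed_disc_bounded[OF assms] by blast
  then have "AE z in disc_measure. norm (h z) \<le> M" by (intro AE_I2) auto
  then show ?thesis using cont_closed_disc_measurable[OF assms] by (auto simp: Linf_def)
qed

lemma Linf_diff:
  assumes "u \<in> Linf" "v \<in> Linf"
  shows "(\<lambda>z. u z - v z) \<in> Linf"
proof -
  obtain A B where "AE z in disc_measure. norm (u z) \<le> A" "AE z in disc_measure. norm (v z) \<le> B"
    using assms by (auto simp: Linf_def)
  then have "AE z in disc_measure. norm (u z - v z) \<le> A + B"
    by eventually_elim (rule order_trans[OF norm_triangle_ineq4], simp)
  then show ?thesis using assms by (auto simp: Linf_def)
qed

theorem theorem4:
  fixes \<psi> h :: "complex \<Rightarrow> complex"
  assumes "\<psi> \<in> annihilator_plus_C"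
    and "h \<in> cont_closed_disc"
  shows "(\<lambda>z. h z * \<psi> z) \<in> annihilator_plus_C"
proof -
  obtain \<alpha> g where \<psi>: "\<psi> \<in> Linf" and \<alpha>: "\<alpha> \<in> bergman1_annihilator" and g: "g \<in> cont_closed_disc"
    and eq: "AE z in disc_measure. \<psi> z = \<alpha> z + g z"
    using assms(1) by (auto simp: annihilator_plus_C_def)
  define u where "u = (\<lambda>z. h z * \<alpha> z)"
  define \<phi> where "\<phi> = bergman_potential u"
  have u: "u \<in> Linf"
    using \<alpha> assms(2) unfolding u_def by (intro Linf_mult_cont) (simp add: bergman1_annihilator_def)
  have \<phi>: "\<phi> \<in> cont_closed_disc"
    unfolding \<phi>_def u_def cont_closed_disc_def
    using continuous_on_bergman_potential[OF \<alpha> assms(2)] by simp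
  have "(LINT z|disc_measure. f z * cnj (u z - \<phi> z)) = 0" if f: "f \<in> bergman1" for f
  proof -
    have "(LINT z|disc_measure. f z * cnj (u z - \<phi> z)) =
        (LINT z|disc_measure. f z * cnj (u z) - f z * cnj (\<phi> z))"
      by (simp add: right_diff_distrib)
    also have "\<dots> = (LINT z|disc_measure. f z * cnj (u z)) - (LINT z|disc_measure. f z * cnj (\<phi> z))"
      by (intro Bochner_Integration.integral_diff integrable_bergman1_times_cnj_Linf f u
          cont_closed_disc_Linf \<phi>)
    also have "\<dots> = 0"
      unfolding \<phi>_def integral_bergman1_times_cnj_potential[OF f u] by simp
    finally show ?thesis .
  qed
  then have "(\<lambda>z. u z - \<phi> z) \<in> bergman1_annihilator"
    using Linf_diff[OF u cont_closed_disc_Linf[OF \<phi>]] by (simp add: bergman1_annihilator_def)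
  \<comment> \<open>The correction subtracted from \<open>u\<close> is returned to the continuous
    summand, which leaves the sum \<open>h z * \<psi> z\<close> unchanged.\<close>
  moreover have "(\<lambda>z. \<phi> z + h z * g z) \<in> cont_closed_disc"
    using \<phi> g assms(2) by (auto simp: cont_closed_disc_def intro!: continuous_intros)
  moreover have "AE z in disc_measure. h z * \<psi> z = (u z - \<phi> z) + (\<phi> z + h z * g z)"
    using eq by eventually_elim (simp add: u_def algebra_simps)
  ultimately show ?thesis
    unfolding annihilator_plus_C_def mem_Collect_eq
    by (intro conjI Linf_mult_cont[OF \<psi> assms(2)] bexI)
qed

end
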